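(* Let $L\ge4$ be an even integer and let $\{X(t)\}_{t\ge0}$ be the activity process on the $L\times L$ toric grid with $p=1$ and $\mu=1$, so that $\sigma=\nu$. For any $\sigma>1$ the mixing time of $\{X(t)\}_{t\ge0}$ satisfies $$t_{\rm mix}(\varepsilon,\sigma)\;\ge\;\Big(\frac12-2\varepsilon\Big)\,\frac{\sigma^{L}}{|\partial^-\mathcal S|\,(L^2/2-L)} ,$$ where $\mathcal S=\{I\in\Omega:\phi(\mathcal E,I)\le L\}$ and $\partial^-\mathcal S$ is its inner boundary.
   Context: Toric grid: $G=(V,E)$ with $V=\{1,\dots,L\}^2$, $L$ even, two vertices being adjacent iff they differ by $1\pmod L$ in exactly one coordinate. $\mathcal E$ is the set of vertices with even coordinate sum. $\Omega$ is the collection of independent sets of $G$. Activity process (with $p=\mu=1$): the continuous-time Markov process on $\Omega$ which from $I$ jumps to $I\cup\{v\}$ at rate $\nu=\sigma$ for each $v\notin I$ with $I\cup\{v\}\in\Omega$, and to $I\setminus\{v\}$ at rate $1$ for each $v\in I$. Its stationary distribution is $\pi(I)=\sigma^{|I|}/\sum_{J\in\Omega}\sigma^{|J|}$. Mixing time: $d(t):=\max_{x\in\Omega}\|\mathbb P(X(t)\in\cdot\mid X(0)=x)-\pi\|_{\rm TV}$ with $\|q-r\|_{\rm TV}=\frac12\sum_{x\in\Omega}|q(x)-r(x)|$, and $t_{\rm mix}(\varepsilon,\sigma)=\inf\{t\ge0:d(t)\le\varepsilon\}$, for $\varepsilon>0$. Communication height: $\Delta(I):=L^2/2-|I|$; a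 path $\omega:I\to I'$ is a finite sequence of elements of $\Omega$ from $I$ to $I'$ in which consecutive sets differ by adding or removing exactly one vertex; $\phi(I,I'):=\min_{\omega:I\to I'}\max_{J\in\omega}\Delta(J)$. The inner boundary $\partial^-\mathcal S$ is the set of $I\in\mathcal S$ for which there is $J\in\Omega\setminus\mathcal S$ with $|I\triangle J|=1$. *)

theory Defs
  imports "HOL-Probability.Probability" "HOL-Number_Theory.Cong"
begin

section \<open>Markov jump processes on a finite state space\<close>

text \<open>
  A Markov process is a family of laws \<open>P x\<close>, one for each starting state \<open>x\<close>, together with
  random variables \<open>X t\<close>; thus \<open>P x\<close> plays the role of conditioning on \<open>X 0 = x\<close>.
  The fifth conjunct is the (time-homogeneous) Markov property: given the values at a finite set
  \<open>T\<close> of times up to \<open>s \<in> T\<close>, the position at time \<open>s + h\<close> is distributed as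
  that at time \<open>h\<close> when starting afresh from the state at time \<open>s\<close>. It is multiplied out, to avoid
  conditioning on null events. The last conjunct says that the process jumps from \<open>x\<close> to
  \<open>y\<close> at rate \<open>q x y\<close>.
\<close>

definition markov_jump_process ::
    "'s set \<Rightarrow> ('s \<Rightarrow> 's \<Rightarrow> real) \<Rightarrow> ('s \<Rightarrow> 'w measure) \<Rightarrow> (real \<Rightarrow> 'w \<Rightarrow> 's) \<Rightarrow> bool" where
  "markov_jump_process S q P X \<longleftrightarrow>
     (\<forall>x\<in>S. prob_space (P x)) \<and>
     (\<forall>x\<in>S. \<forall>t\<ge>0. X t \<in> measurable (P x) (count_space S)) \<and>
     (\<forall>x\<in>S. AE \<omega> in P x. X 0 \<omega> = x) \<and>
     (\<forall>x\<in>S. AE \<omega> in P x. \<forall>t\<ge>0. \<forall>\<^sub>F s in at_right t. X s \<omega> = X t \<omega>) \<and>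
     (\<forall>x\<in>S. \<forall>T f s h y. finite T \<longrightarrow> T \<subseteq> {0..s} \<longrightarrow> s \<in> T \<longrightarrow> h \<ge> 0 \<longrightarrow> f ` T \<subseteq> S \<longrightarrow> y \<in> S \<longrightarrow>
        \<P>(\<omega> in P x. (\<forall>r\<in>T. X r \<omega> = f r) \<and> X (s + h) \<omega> = y) =
        \<P>(\<omega> in P x. \<forall>r\<in>T. X r \<omega> = f r) * \<P>(\<omega> in P (f s). X h \<omega> = y)) \<and>
     (\<forall>x\<in>S. \<forall>y\<in>S. x \<noteq> y \<longrightarrow>
        ((\<lambda>h. \<P>(\<omega> in P x. X h \<omega> = y) / h) \<longlongrightarrow> q x y) (at_right 0))"

definition tv_norm :: "'s set \<Rightarrow> ('s \<Rightarrow> real) \<Rightarrow> ('s \<Rightarrow> real) \<Rightarrow> real" where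
  "tv_norm S q r = (1/2) * (\<Sum>x\<in>S. \<bar>q x - r x\<bar>)"

definition max_tv_distance ::
    "'s set \<Rightarrow> ('s \<Rightarrow> real) \<Rightarrow> ('s \<Rightarrow> 'w measure) \<Rightarrow> (real \<Rightarrow> 'w \<Rightarrow> 's) \<Rightarrow> real \<Rightarrow> real" where
  "max_tv_distance S \<pi> P X t =
     Max ((\<lambda>x. tv_norm S (\<lambda>y. \<P>(\<omega> in P x. X t \<omega> = y)) \<pi>) ` S)"

text \<open>Extended reals give the infimum its usual meaning (\<open>Inf {} = \<infinity>\<close>).\<close>

definition mixing_time ::
    "'s set \<Rightarrow> ('s \<Rightarrow> real) \<Rightarrow> ('s \<Rightarrow> 'w measure) \<Rightarrow> (real \<Rightarrow> 'w \<Rightarrow> 's) \<Rightarrow> real \<Rightarrow> ereal" where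
  "mixing_time S \<pi> P X \<epsilon> = Inf (ereal ` {t. t \<ge> 0 \<and> max_tv_distance S \<pi> P X t \<le> \<epsilon>})"


section \<open>The toric grid and its independent sets\<close>

type_synonym vertex = "nat \<times> nat"

definition grid :: "nat \<Rightarrow> vertex set" where
  "grid L = {1..L} \<times> {1..L}"

definition differ_by_1 :: "nat \<Rightarrow> nat \<Rightarrow> nat \<Rightarrow> bool" where
  "differ_by_1 L a b \<longleftrightarrow> [a = b + 1] (mod L) \<or> [b = a + 1] (mod L)"

definition adjacent :: "nat \<Rightarrow> vertex \<Rightarrow> vertex \<Rightarrow> bool" where
  "adjacent L u v \<longleftrightarrow> u \<in> grid L \<and> v \<in> grid L \<and>
     (fst u = fst v \<and> differ_by_1 L (snd u) (snd v) \<or>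
      snd u = snd v \<and> differ_by_1 L (fst u) (fst v))"

definition indep_sets :: "nat \<Rightarrow> vertex set set" where
  "indep_sets L = {I. I \<subseteq> grid L \<and> (\<forall>u\<in>I. \<forall>v\<in>I. \<not> adjacent L u v)}"

definition even_sites :: "nat \<Rightarrow> vertex set" where
  "even_sites L = {v \<in> grid L. even (fst v + snd v)}"


section \<open>The activity process\<close>

definition activity_rate :: "nat \<Rightarrow> real \<Rightarrow> vertex set \<Rightarrow> vertex set \<Rightarrow> real" where
  "activity_rate L \<sigma> I J =
     (if J \<in> indep_sets L \<and> (\<exists>v. v \<notin> I \<and> J = insert v I) then \<sigma>
      else if \<exists>v\<in>I. J = I - {v} then 1
      else 0)"

definition activity_process ::
    "nat \<Rightarrow> real \<Rightarrow> (vertex set \<Rightarrow> 'w measure) \<Rightarrow> (real \<Rightarrow> 'w \<Rightarrow> vertex set) \<Rightarrow> bool" where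
  "activity_process L \<sigma> P X \<longleftrightarrow>
     markov_jump_process (indep_sets L) (activity_rate L \<sigma>) P X"

definition stationary :: "nat \<Rightarrow> real \<Rightarrow> vertex set \<Rightarrow> real" where
  "stationary L \<sigma> I = \<sigma> ^ card I / (\<Sum>J\<in>indep_sets L. \<sigma> ^ card J)"


section \<open>Communication height\<close>

definition inefficiency :: "nat \<Rightarrow> vertex set \<Rightarrow> real" where
  "inefficiency L I = real (L\<^sup>2) / 2 - real (card I)"

definition differ_in_one_vertex :: "vertex set \<Rightarrow> vertex set \<Rightarrow> bool" where
  "differ_in_one_vertex I J \<longleftrightarrow> card ((I - J) \<union> (J - I)) = 1"

definition is_path :: "nat \<Rightarrow> vertex set \<Rightarrow> vertex set list \<Rightarrow> vertex set \<Rightarrow> bool" where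
  "is_path L I \<omega> I' \<longleftrightarrow> \<omega> \<noteq> [] \<and> hd \<omega> = I \<and> last \<omega> = I' \<and> set \<omega> \<subseteq> indep_sets L \<and>
     successively differ_in_one_vertex \<omega>"

text \<open>The set of heights below is finite, since \<open>inefficiency L\<close> takes finitely many
  values on \<open>indep_sets L\<close>, and nonempty for independent sets, since any two of them are joined by
  a path through the empty set.\<close>

definition communication_height :: "nat \<Rightarrow> vertex set \<Rightarrow> vertex set \<Rightarrow> real" where
  "communication_height L I I' = Min {Max (inefficiency L ` set \<omega>) | \<omega>. is_path L I \<omega> I'}"

definition even_well :: "nat \<Rightarrow> vertex set set" where
  "even_well L = {I \<in> indep_sets L. communication_height L (even_sites L) I \<le> real L}"

definition inner_boundary :: "nat \<Rightarrow> vertex set set \<Rightarrow> vertex set set" where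
  "inner_boundary L S = {I \<in> S. \<exists>J \<in> indep_sets L - S. differ_in_one_vertex I J}"

end

theory Submission
  imports Defs
begin

text \<open>
  The stationary chance of having left a set \<open>A\<close> by time \<open>t\<close>, starting in \<open>A\<close>, is subadditive in
  \<open>t\<close>, hence at most \<open>t\<close> times its derivative at \<open>0\<close>, the stationary flow out of \<open>A\<close>; if
  \<open>\<pi>(A) \<le> 1/2\<close>, this bounds the mixing time from below. The well of the even ground state can only
  be left by removing a particle at height exactly \<open>L\<close>, so the flow out of it carries the factor
  \<open>\<sigma>\<^sup>-\<^sup>L\<close> relative to the weight of the ground state. The well has mass at most \<open>1/2\<close> because
  it is disjoint from its image under the reflection \<open>x \<mapsto> L + 1 - x\<close>, which swaps the two ground
  states: below height \<open>L\<close> some row and some column are completely filled by sites of one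
  common parity, and this parity cannot change along a path of height at most \<open>L\<close>.
\<close>

section \<open>Independent sets of low height contain a cross\<close>

lemma differ_by_1_iff:
  assumes "a \<in> {1..L}" "b \<in> {1..L}" "L \<ge> 2"
  shows "differ_by_1 L a b \<longleftrightarrow> a = b + 1 \<or> b = a + 1 \<or> a = 1 \<and> b = L \<or> a = L \<and> b = 1"
proof -
  have key: "[a = b + 1] (mod L) \<longleftrightarrow> a = b + 1 \<or> a = 1 \<and> b = L"
    if "a \<in> {1..L}" "b \<in> {1..L}" for a b
  proof (cases "b = L")
    case True
    have "[a = b + 1] (mod L) \<longleftrightarrow> [a = 1] (mod L)"
      unfolding True cong_def by (metis mod_add_self1)
    also have "\<dots> \<longleftrightarrow> a = 1"
      using that assms(3) by (cases "a = L") (auto simp: cong_def)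
    finally show ?thesis
      using True that by auto
  next
    case False
    have "(b + 1) mod L = (if b + 1 = L then 0 else b + 1)" "a mod L = (if a = L then 0 else a)"
      using that False by auto
    then show ?thesis
      using that False by (auto simp: cong_def simp del: mod_Suc)
  qed
  show ?thesis
    using key[OF assms(1,2)] key[OF assms(2,1)] by (auto simp: differ_by_1_def)
qed

text \<open>On a cycle of length at least 4 a point has two distinct neighbours, so one of them
  avoids \<open>z\<close>; parity also flips across the seam between \<open>L\<close> and 1 because
  \<open>L\<close> is even. Where a site \<open>w\<close> may be missing from a configuration,
  \<open>z\<close> is one of its coordinates.\<close>

lemma neighbour_avoiding:
  assumes "a \<in> {1..L}" "L \<ge> 4" "even L"
  obtains b where "b \<in> {1..L}" "b \<noteq> z" "differ_by_1 L a b" "even b \<longleftrightarrow> odd a"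
proof -
  define b1 where "b1 = (if a = L then 1 else a + 1)"
  define b2 where "b2 = (if a = 1 then L else a - 1)"
  have ne: "b1 \<noteq> b2" and in1: "b1 \<in> {1..L}" and in2: "b2 \<in> {1..L}"
    using assms by (auto simp: b1_def b2_def)
  have "differ_by_1 L a b1" "differ_by_1 L a b2"
    using differ_by_1_iff[OF assms(1) in1] differ_by_1_iff[OF assms(1) in2] assms
    by (auto simp: b1_def b2_def)
  moreover have "even b1 \<longleftrightarrow> odd a" "even b2 \<longleftrightarrow> odd a"
    using assms by (auto simp: b1_def b2_def)
  ultimately show ?thesis
    using that[OF in1] that[OF in2] ne by metis
qed

text \<open>\<open>C\<close> and its shift by one are disjoint and together have at least
  \<open>L\<close> elements, so they tile the cycle and membership in \<open>C\<close>
  alternates.\<close>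

lemma cyclic_alternating:
  assumes "C \<subseteq> {1..L}" "\<And>a b. a \<in> C \<Longrightarrow> b \<in> C \<Longrightarrow> \<not> differ_by_1 L a b"
    and "L \<ge> 4" "2 * card C \<ge> L"
  obtains p where "\<And>a. a \<in> {1..L} \<Longrightarrow> even a = p \<Longrightarrow> a \<in> C"
proof -
  define nx where "nx a = (if a = L then 1 else a + 1)" for a
  have fin: "finite C" using assms(1) finite_subset by auto
  have nx_in: "nx a \<in> {1..L}" if "a \<in> {1..L}" for a
    using that assms(3) by (auto simp: nx_def)
  have nx_adj: "differ_by_1 L a (nx a)" if "a \<in> {1..L}" for a
    using that nx_in[OF that] assms(3) by (subst differ_by_1_iff) (auto simp: nx_def)
  have inj: "inj_on nx {1..L}"
    by (auto simp: inj_on_def nx_def split: if_splits)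
  have disj: "C \<inter> nx ` C = {}"
    using assms(1,2) nx_adj by blast
  have "card (C \<union> nx ` C) = card C + card C"
    using disj fin card_image[OF inj_on_subset[OF inj assms(1)]] by (simp add: card_Un_disjoint)
  moreover have sub: "C \<union> nx ` C \<subseteq> {1..L}"
    using assms(1) nx_in by auto
  ultimately have all: "C \<union> nx ` C = {1..L}"
    using assms(4) by (intro card_seteq) auto
  have alt: "Suc a \<in> C \<longleftrightarrow> a \<notin> C" if "a \<in> {1..L}" "Suc a \<le> L" for a
  proof -
    have s: "nx a = Suc a" using that by (simp add: nx_def)
    have "Suc a \<in> C \<union> nx ` C" using all that by auto
    moreover have "Suc a \<in> nx ` C \<longleftrightarrow> a \<in> C"
      using inj assms(1) that(1) s by (metis inj_on_image_mem_iff)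
    ultimately show ?thesis
      using disj by blast
  qed
  have mem: "a \<in> C \<longleftrightarrow> (odd a \<longleftrightarrow> 1 \<in> C)" if "1 \<le> a" "a \<le> L" for a
    using that
  proof (induction a rule: dec_induct)
    case (step n)
    then show ?case using alt[of n] by auto
  qed auto
  \<comment> \<open>The witness for \<open>p\<close> is \<open>1 \<notin> C\<close>: the odd class
    if 1 belongs to \<open>C\<close>, the even class otherwise.\<close>
  have "a \<in> C" if "a \<in> {1..L}" "even a = (1 \<notin> C)" for a
    using that mem[of a] by (cases "1 \<in> C") simp_all
  then show ?thesis
    by (rule that)
qed

text \<open>Full means that all sites of one parity class are occupied, which is the most that
  independence allows in a row of even length. The class is a Boolean, \<open>True\<close> for even
  sites, so that \<open>\<not> p\<close> names the opposite one.\<close>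

definition full_row :: "nat \<Rightarrow> bool \<Rightarrow> vertex set \<Rightarrow> nat \<Rightarrow> bool" where
  "full_row L p I r \<longleftrightarrow> (\<forall>y\<in>{1..L}. even (r + y) = p \<longrightarrow> (r, y) \<in> I)"

definition full_column :: "nat \<Rightarrow> bool \<Rightarrow> vertex set \<Rightarrow> nat \<Rightarrow> bool" where
  "full_column L p I c \<longleftrightarrow> (\<forall>x\<in>{1..L}. even (x + c) = p \<longrightarrow> (x, c) \<in> I)"

definition cross :: "nat \<Rightarrow> bool \<Rightarrow> vertex set \<Rightarrow> bool" where
  "cross L p I \<longleftrightarrow> (\<exists>r\<in>{1..L}. \<exists>c\<in>{1..L}. full_row L p I r \<and> full_column L p I c)"

lemma full_rowD: "full_row L p I r \<Longrightarrow> y \<in> {1..L} \<Longrightarrow> even (r + y) = p \<Longrightarrow> (r, y) \<in> I"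
  by (simp add: full_row_def)

lemma full_columnD: "full_column L p I c \<Longrightarrow> x \<in> {1..L} \<Longrightarrow> even (x + c) = p \<Longrightarrow> (x, c) \<in> I"
  by (simp add: full_column_def)

section \<open>Elementary facts on adjacency and independent sets\<close>

lemma row_adjacent:
  "x \<in> {1..L} \<Longrightarrow> a \<in> {1..L} \<Longrightarrow> b \<in> {1..L} \<Longrightarrow> differ_by_1 L a b \<Longrightarrow> adjacent L (x, a) (x, b)"
  by (simp add: adjacent_def grid_def)

lemma column_adjacent:
  "y \<in> {1..L} \<Longrightarrow> a \<in> {1..L} \<Longrightarrow> b \<in> {1..L} \<Longrightarrow> differ_by_1 L a b \<Longrightarrow> adjacent L (a, y) (b, y)"
  by (simp add: adjacent_def grid_def)

lemma indep_setsD: "I \<in> indep_sets L \<Longrightarrow> u \<in> I \<Longrightarrow> v \<in> I \<Longrightarrow> \<not> adjacent L u v"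
  by (simp add: indep_sets_def)

lemma finite_indep_sets: "finite (indep_sets L)"
proof -
  have "indep_sets L \<subseteq> Pow (grid L)" by (auto simp: indep_sets_def)
  then show ?thesis by (rule finite_subset) (simp add: grid_def)
qed

lemma indep_sets_finite: "I \<in> indep_sets L \<Longrightarrow> finite I"
  by (auto simp: indep_sets_def grid_def intro: finite_subset)

lemma indep_sets_subset: "I \<in> indep_sets L \<Longrightarrow> J \<subseteq> I \<Longrightarrow> J \<in> indep_sets L"
  by (auto simp: indep_sets_def)

lemma swap_indep_sets:
  assumes "I \<in> indep_sets L"
  shows "prod.swap ` I \<in> indep_sets L"
proof -
  have "adjacent L (prod.swap u) (prod.swap v) \<longleftrightarrow> adjacent L u v" for u v
    by (cases u; cases v) (auto simp: adjacent_def grid_def)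
  then show ?thesis
    using assms by (auto simp: indep_sets_def grid_def)
qed

text \<open>Pigeonhole: the last hypothesis says that the height is below \<open>L\<close>, so the
  mean row occupation exceeds \<open>L/2 - 1\<close>. Some row then has at least \<open>L/2\<close>
  sites, and such a row alternates.\<close>

lemma full_row_exists:
  assumes "I \<in> indep_sets L" "L \<ge> 4" "even L" "L * L < 2 * card I + 2 * L"
  obtains r p where "r \<in> {1..L}" "full_row L p I r"
proof -
  define row where "row r = {y. (r, y) \<in> I}" for r
  have I: "I = (SIGMA r:{1..L}. row r)"
    using assms(1) by (auto simp: row_def indep_sets_def grid_def)
  have row_sub: "row r \<subseteq> {1..L}" for r
    using assms(1) by (auto simp: row_def indep_sets_def grid_def)
  have "\<exists>r\<in>{1..L}. L \<le> 2 * card (row r)"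
  proof (rule ccontr)
    assume "\<not> ?thesis"
    then have lt: "2 * card (row r) < L" if "r \<in> {1..L}" for r
      using that by (simp add: not_le)
    \<comment> \<open>Both sides of the strict inequality are even, so it improves by 2; summed over
      the rows this is exactly the slack \<open>2 * L\<close>.\<close>
    have "2 * card (row r) + 2 \<le> L" if "r \<in> {1..L}" for r
      using lt[OF that] assms(3) by presburger
    then have "(\<Sum>r\<in>{1..L}. 2 * card (row r) + 2) \<le> (\<Sum>r\<in>{1..L}. L)"
      by (intro sum_mono)
    moreover have "card I = (\<Sum>r\<in>{1..L}. card (row r))"
      unfolding I using row_sub finite_subset by (subst card_SigmaI) blast+
    moreover have "(\<Sum>r\<in>{1..L}. 2 * card (row r) + 2) = 2 * (\<Sum>r\<in>{1..L}. card (row r)) + 2 * L"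
      unfolding sum.distrib sum_distrib_left by simp
    moreover have "(\<Sum>r\<in>{1..L}. L) = L * L"
      by simp
    ultimately show False
      using assms(4) by linarith
  qed
  then obtain r where r: "r \<in> {1..L}" "L \<le> 2 * card (row r)"
    by blast
  have "\<not> differ_by_1 L a b" if "a \<in> row r" "b \<in> row r" for a b
    using that subsetD[OF row_sub that(1)] subsetD[OF row_sub that(2)] row_adjacent[OF r(1)]
      indep_setsD[OF assms(1)] unfolding row_def by blast
  then obtain p where p: "\<And>a. a \<in> {1..L} \<Longrightarrow> even a = p \<Longrightarrow> a \<in> row r"
    using cyclic_alternating[OF row_sub _ assms(2) r(2)] by blast
  \<comment> \<open>\<open>p\<close> is the parity of the column index alone, whereas
    \<open>full_row\<close> refers to the coordinate sum; \<open>even r = p\<close> converts one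
    into the other.\<close>
  have "full_row L (even r = p) I r"
    unfolding full_row_def
  proof (intro ballI impI)
    fix y assume "y \<in> {1..L}" "even (r + y) = (even r = p)"
    then show "(r, y) \<in> I"
      using p[of y] by (cases "even r") (auto simp: row_def)
  qed
  then show ?thesis
    by (rule that[OF r(1)])
qed

text \<open>Transposition exchanges rows and columns and preserves independence and
  cardinality.\<close>

lemma full_column_exists:
  assumes "I \<in> indep_sets L" "L \<ge> 4" "even L" "L * L < 2 * card I + 2 * L"
  obtains c p where "c \<in> {1..L}" "full_column L p I c"
proof -
  have "card (prod.swap ` I) = card I"
    by (simp add: card_image)
  then obtain c p where "c \<in> {1..L}" "full_row L p (prod.swap ` I) c"
    using full_row_exists[OF swap_indep_sets[OF assms(1)] assms(2,3)] assms(4) by metis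
  then show ?thesis
    by (intro that[of c p]) (auto simp: full_row_def full_column_def add.commute)
qed

text \<open>If the full row and the full column had opposite parities, their crossing would be
  occupied as a site of one line, and its neighbours along the other line would be occupied
  too.\<close>

lemma cross_exists:
  assumes "I \<in> indep_sets L" "L \<ge> 4" "even L" "L * L < 2 * card I + 2 * L"
  obtains p where "cross L p I"
proof -
  obtain r p where r: "r \<in> {1..L}" "full_row L p I r"
    using full_row_exists[OF assms] .
  obtain c p' where c: "c \<in> {1..L}" "full_column L p' I c"
    using full_column_exists[OF assms] .
  have "p = p'"
  proof (rule ccontr)
    assume ne: "p \<noteq> p'"
    obtain x where x: "x \<in> {1..L}" "differ_by_1 L r x" "even x \<longleftrightarrow> odd r"
      using neighbour_avoiding[OF r(1) assms(2,3)] .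
    obtain y where y: "y \<in> {1..L}" "differ_by_1 L c y" "even y \<longleftrightarrow> odd c"
      using neighbour_avoiding[OF c(1) assms(2,3)] .
    show False
    proof (cases "even (r + c) = p")
      case True
      then have "(r, c) \<in> I" "(x, c) \<in> I"
        using full_rowD[OF r(2) c(1)] full_columnD[OF c(2) x(1)] x(3) ne by auto
      then show False
        using indep_setsD[OF assms(1)] column_adjacent[OF c(1) r(1) x(1,2)] by blast
    next
      case False
      then have "(r, c) \<in> I" "(r, y) \<in> I"
        using full_rowD[OF r(2) y(1)] full_columnD[OF c(2) r(1)] y(3) ne by auto
      then show False
        using indep_setsD[OF assms(1)] row_adjacent[OF r(1) c(1) y(1,2)] by blast
    qed
  qed
  then show ?thesis
    using r c by (intro that[of p]) (auto simp: cross_def)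
qed

text \<open>The even column of \<open>A\<close> meets the odd row of \<open>B\<close> in an odd site, which cannot belong to \<open>A\<close>
  and hence is \<open>w\<close>; likewise for the even row and the odd column. So both crosses are centred at \<open>w\<close>,
  and the row of \<open>w\<close> contains sites of both parities.\<close>

lemma opposite_crosses:
  assumes "A \<in> indep_sets L" "L \<ge> 4" "even L" "cross L p A" "cross L (\<not> p) B" "B - {w} \<subseteq> A"
  shows False
proof -
  obtain r c where rc: "r \<in> {1..L}" "c \<in> {1..L}" "full_row L p A r" "full_column L p A c"
    using assms(4) by (auto simp: cross_def)
  obtain r' c' where rc': "r' \<in> {1..L}" "c' \<in> {1..L}" "full_row L (\<not> p) B r'" "full_column L (\<not> p) B c'"
    using assms(5) by (auto simp: cross_def)
  have inA: "v \<in> A" if "v \<in> B" "v \<noteq> w" for v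
    using assms(6) that by auto
  have w1: "w = (r', c)"
  proof (rule ccontr)
    assume ne: "w \<noteq> (r', c)"
    show False
    proof (cases "even (r' + c) = p")
      case True
      \<comment> \<open>A crossing of parity \<open>p\<close> lies in \<open>A\<close> by the
        column. Its neighbours in the row lie in \<open>B\<close>, and one that differs from
        \<open>w\<close> lies in \<open>A\<close> as well.\<close>
      obtain y where y: "y \<in> {1..L}" "y \<noteq> snd w" "differ_by_1 L c y" "even y \<longleftrightarrow> odd c"
        using neighbour_avoiding[OF rc(2) assms(2,3)] .
      have "(r', y) \<in> A"
        using True y by (intro inA full_rowD[OF rc'(3)]) auto
      moreover have "(r', c) \<in> A"
        using True by (intro full_columnD[OF rc(4) rc'(1)])
      ultimately show False
        using indep_setsD[OF assms(1)] row_adjacent[OF rc'(1) rc(2) y(1,3)] by blast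
    next
      case False
      obtain x where x: "x \<in> {1..L}" "differ_by_1 L r' x" "even x \<longleftrightarrow> odd r'"
        using neighbour_avoiding[OF rc'(1) assms(2,3)] .
      have "(r', c) \<in> A"
        using False ne by (intro inA full_rowD[OF rc'(3) rc(2)]) auto
      moreover have "(x, c) \<in> A"
        using False x by (intro full_columnD[OF rc(4)]) auto
      ultimately show False
        using indep_setsD[OF assms(1)] column_adjacent[OF rc(2) rc'(1) x(1,2)] by blast
    qed
  qed
  have w2: "w = (r, c')"
  proof (rule ccontr)
    assume ne: "w \<noteq> (r, c')"
    show False
    proof (cases "even (r + c') = p")
      case True
      obtain x where x: "x \<in> {1..L}" "x \<noteq> fst w" "differ_by_1 L r x" "even x \<longleftrightarrow> odd r"
        using neighbour_avoiding[OF rc(1) assms(2,3)] .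
      have "(x, c') \<in> A"
        using True x by (intro inA full_columnD[OF rc'(4)]) auto
      moreover have "(r, c') \<in> A"
        using True by (intro full_rowD[OF rc(3) rc'(2)])
      ultimately show False
        using indep_setsD[OF assms(1)] column_adjacent[OF rc'(2) rc(1) x(1,3)] by blast
    next
      case False
      obtain y where y: "y \<in> {1..L}" "differ_by_1 L c' y" "even y \<longleftrightarrow> odd c'"
        using neighbour_avoiding[OF rc'(2) assms(2,3)] .
      have "(r, c') \<in> A"
        using False ne by (intro inA full_columnD[OF rc'(4) rc(1)]) auto
      moreover have "(r, y) \<in> A"
        using False y by (intro full_rowD[OF rc(3)]) auto
      ultimately show False
        using indep_setsD[OF assms(1)] row_adjacent[OF rc(1) rc'(2) y(1,2)] by blast
    qed
  qed
  have eq: "r' = r"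
    using w1 w2 by simp
  \<comment> \<open>One of the columns 1 and 2 gives a site of parity \<open>p\<close> in row
    \<open>r\<close>, which \<open>A\<close> contains. A row neighbour of it other than
    \<open>w\<close> comes from the full row of \<open>B\<close>, now known to be the same
    row.\<close>
  define a where "a = (if even (r + 1) = p then 1 else 2::nat)"
  have a: "a \<in> {1..L}" "even (r + a) = p"
    using assms(2) by (auto simp: a_def)
  obtain y where y: "y \<in> {1..L}" "y \<noteq> snd w" "differ_by_1 L a y" "even y \<longleftrightarrow> odd a"
    using neighbour_avoiding[OF a(1) assms(2,3)] .
  have "(r, y) \<in> A"
    using a y rc'(3) unfolding eq by (intro inA full_rowD[of L "\<not> p" B]) auto
  moreover have "(r, a) \<in> A"
    using full_rowD[OF rc(3) a] .
  ultimately show False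
    using indep_setsD[OF assms(1)] row_adjacent[OF rc(1) a(1) y(1,3)] by blast
qed

section \<open>The even well and its reflection\<close>

lemma differ_by_1_parity:
  assumes "even L" "differ_by_1 L a b"
  shows "even a \<longleftrightarrow> odd b"
proof -
  \<comment> \<open>As 2 divides \<open>L\<close>, a congruence modulo \<open>L\<close> descends to
    one modulo 2.\<close>
  have "even x \<longleftrightarrow> odd y" if "[x = y + 1] (mod L)" for x y
    using cong_dvd_modulus_nat[OF that assms(1)] unfolding cong_def by presburger
  from this[of a b] this[of b a] show ?thesis
    using assms(2) by (auto simp: differ_by_1_def)
qed

lemma adjacent_parity:
  assumes "even L" "adjacent L u v"
  shows "even (fst u + snd u) \<longleftrightarrow> odd (fst v + snd v)"
  using assms(2) differ_by_1_parity[OF assms(1), of "fst u" "fst v"]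
    differ_by_1_parity[OF assms(1), of "snd u" "snd v"]
  unfolding adjacent_def even_add by metis

lemma even_sites_indep:
  assumes "even L"
  shows "even_sites L \<in> indep_sets L"
  using adjacent_parity[OF assms] unfolding indep_sets_def even_sites_def by blast

text \<open>\<open>L + 1\<close> is odd for even \<open>L\<close>, so reflecting one coordinate
  flips parity, while reflecting both would preserve it. The map is its own inverse on the grid;
  outside, subtraction on the naturals truncates.\<close>

definition reflect :: "nat \<Rightarrow> vertex \<Rightarrow> vertex" where
  "reflect L v = (L + 1 - fst v, snd v)"

lemma reflect_grid: "v \<in> grid L \<Longrightarrow> reflect L v \<in> grid L"
  by (auto simp: grid_def reflect_def)

lemma reflect_reflect: "v \<in> grid L \<Longrightarrow> reflect L (reflect L v) = v"
  by (auto simp: grid_def reflect_def)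

lemma reflect_image_reflect:
  assumes "I \<subseteq> grid L"
  shows "reflect L ` reflect L ` I = I"
proof -
  have "(\<lambda>v. reflect L (reflect L v)) ` I = id ` I"
    using assms by (intro image_cong) (auto intro: reflect_reflect)
  then show ?thesis
    by (simp add: image_image)
qed

lemma inj_on_reflect: "I \<subseteq> grid L \<Longrightarrow> inj_on (reflect L) I"
  by (rule inj_on_inverseI[where g = "reflect L"]) (auto intro: reflect_reflect)

lemma card_reflect: "I \<subseteq> grid L \<Longrightarrow> card (reflect L ` I) = card I"
  by (simp add: card_image inj_on_reflect)

text \<open>Reflection reverses the orientation of the cycle: it exchanges successor and
  predecessor, also across the seam.\<close>

lemma differ_by_1_reflect:
  assumes "differ_by_1 L (L + 1 - a) (L + 1 - b)" "a \<in> {1..L}" "b \<in> {1..L}" "L \<ge> 2"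
  shows "differ_by_1 L a b"
proof -
  have "L + 1 - a \<in> {1..L}" "L + 1 - b \<in> {1..L}"
    using assms(2,3) by auto
  from assms(1)[unfolded differ_by_1_iff[OF this assms(4)]]
  show ?thesis
    unfolding differ_by_1_iff[OF assms(2-4)] using assms(2,3) by auto
qed

lemma adjacent_reflect:
  assumes "adjacent L (reflect L u) (reflect L v)" "u \<in> grid L" "v \<in> grid L" "L \<ge> 2"
  shows "adjacent L u v"
proof -
  obtain a b c d where uv: "u = (a, b)" "v = (c, d)"
    by (cases u; cases v)
  have ac: "a \<in> {1..L}" "c \<in> {1..L}"
    using assms(2,3) by (auto simp: uv grid_def)
  have "L + 1 - a = L + 1 - c \<and> differ_by_1 L b d \<or> b = d \<and> differ_by_1 L (L + 1 - a) (L + 1 - c)"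
    using assms(1) by (simp add: adjacent_def reflect_def uv)
  moreover have "a = c" if "L + 1 - a = L + 1 - c"
    using that ac by auto
  ultimately have "a = c \<and> differ_by_1 L b d \<or> b = d \<and> differ_by_1 L a c"
    using differ_by_1_reflect[OF _ ac assms(4)] by blast
  then show ?thesis
    using assms(2,3) by (simp add: adjacent_def uv)
qed

lemma reflect_indep_sets:
  assumes "I \<in> indep_sets L" "L \<ge> 2"
  shows "reflect L ` I \<in> indep_sets L"
proof -
  have "I \<subseteq> grid L"
    using assms(1) by (simp add: indep_sets_def)
  then have "\<not> adjacent L (reflect L u) (reflect L v)" if "u \<in> I" "v \<in> I" for u v
    using that adjacent_reflect[OF _ _ _ assms(2)] indep_setsD[OF assms(1)] by blast
  then show ?thesis
    using \<open>I \<subseteq> grid L\<close> reflect_grid by (auto simp: indep_sets_def)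
qed

lemma reflect_parity:
  "v \<in> grid L \<Longrightarrow> even L \<Longrightarrow>
    even (fst (reflect L v) + snd (reflect L v)) \<longleftrightarrow> odd (fst v + snd v)"
  by (auto simp: grid_def reflect_def)

text \<open>Row \<open>r\<close> moves to row \<open>L + 1 - r\<close>, column \<open>c\<close> is
  mapped to itself, and every site changes parity.\<close>

lemma cross_reflect:
  assumes "even L" "cross L p I"
  shows "cross L (\<not> p) (reflect L ` I)"
proof -
  obtain r c where rc: "r \<in> {1..L}" "c \<in> {1..L}" "full_row L p I r" "full_column L p I c"
    using assms(2) by (auto simp: cross_def)
  have "full_row L (\<not> p) (reflect L ` I) (L + 1 - r)"
    unfolding full_row_def
  proof (intro ballI impI)
    fix y assume "y \<in> {1..L}" "even (L + 1 - r + y) = (\<not> p)"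
    then have "(r, y) \<in> I"
      using assms(1) rc(1) by (intro full_rowD[OF rc(3)]) auto
    then show "(L + 1 - r, y) \<in> reflect L ` I"
      by (force simp: reflect_def)
  qed
  moreover have "full_column L (\<not> p) (reflect L ` I) c"
    unfolding full_column_def
  proof (intro ballI impI)
    fix x assume x: "x \<in> {1..L}" "even (x + c) = (\<not> p)"
    then have "(L + 1 - x, c) \<in> I"
      using assms(1) by (intro full_columnD[OF rc(4)]) auto
    moreover have "reflect L (L + 1 - x, c) = (x, c)"
      using x(1) by (auto simp: reflect_def)
    ultimately show "(x, c) \<in> reflect L ` I"
      by (metis image_eqI)
  qed
  ultimately show ?thesis
    using rc(1,2) unfolding cross_def by (intro bexI[of _ "L + 1 - r"] bexI[of _ c]) auto
qed

text \<open>Reflection is a bijection from the even sites onto the rest of the grid, so each class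
  is half of it.\<close>

lemma card_even_sites:
  assumes "even L"
  shows "2 * card (even_sites L) = L * L"
proof -
  have fin: "finite (grid L)" by (simp add: grid_def)
  have sub: "even_sites L \<subseteq> grid L" by (auto simp: even_sites_def)
  have "reflect L ` even_sites L = grid L - even_sites L"
  proof (intro equalityI subsetI)
    fix v assume "v \<in> reflect L ` even_sites L"
    then obtain u where u: "u \<in> grid L" "even (fst u + snd u)" "v = reflect L u"
      by (auto simp: even_sites_def)
    then show "v \<in> grid L - even_sites L"
      using reflect_parity[OF u(1) assms] reflect_grid[OF u(1)]
      by (simp add: even_sites_def)
  next
    fix v assume v: "v \<in> grid L - even_sites L"
    then have "reflect L v \<in> even_sites L"
      using reflect_parity[OF _ assms, of v] reflect_grid[of v L] by (simp add: even_sites_def)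
    then show "v \<in> reflect L ` even_sites L"
      using reflect_reflect[of v L] v by (metis DiffD1 image_eqI)
  qed
  then have "card (even_sites L) = card (grid L - even_sites L)"
    using card_reflect[OF sub] by simp
  also have "\<dots> = L * L - card (even_sites L)"
    using sub fin by (simp add: card_Diff_subset finite_subset) (simp add: grid_def)
  finally show ?thesis
    using card_mono[OF fin sub] by (simp add: grid_def)
qed

section \<open>Single-site moves, paths and the communication height\<close>

lemma differ_in_one_vertex_cases:
  assumes "differ_in_one_vertex I J"
  obtains (add) v where "v \<notin> I" "J = insert v I" | (remove) v where "v \<in> I" "J = I - {v}"
proof -
  obtain v where v: "(I - J) \<union> (J - I) = {v}"
    using assms card_1_singletonE unfolding differ_in_one_vertex_def by blast
  have sub: "I - J \<subseteq> {v}" "J - I \<subseteq> {v}" and mem: "v \<in> I \<longleftrightarrow> v \<notin> J"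
    using v by auto
  show ?thesis
  proof (cases "v \<in> I")
    case True
    then have "J = I - {v}" using sub mem by auto
    then show ?thesis using remove True by blast
  next
    case False
    then have "J = insert v I" using sub mem by auto
    then show ?thesis using add False by blast
  qed
qed

lemma differ_in_one_vertex_insert: "v \<notin> I \<Longrightarrow> differ_in_one_vertex I (insert v I)"
proof -
  assume "v \<notin> I"
  then have "(I - insert v I) \<union> (insert v I - I) = {v}"
    by auto
  then show ?thesis
    by (simp add: differ_in_one_vertex_def)
qed

lemma differ_in_one_vertex_remove: "v \<in> I \<Longrightarrow> differ_in_one_vertex I (I - {v})"
proof -
  assume "v \<in> I"
  then have "(I - (I - {v})) \<union> (I - {v} - I) = {v}"
    by auto
  then show ?thesis
    by (simp add: differ_in_one_vertex_def)
qed

lemma is_path_singleton: "I \<in> indep_sets L \<Longrightarrow> is_path L I [I] I"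
  by (simp add: is_path_def)

lemma is_path_snoc:
  "is_path L A \<omega> I \<Longrightarrow> differ_in_one_vertex I J \<Longrightarrow> J \<in> indep_sets L \<Longrightarrow> is_path L A (\<omega> @ [J]) J"
  by (auto simp: is_path_def successively_append_iff)

text \<open>Emptying \<open>A\<close> site by site and then filling up \<open>I\<close> only visits
  subsets of \<open>A\<close> or of \<open>I\<close>, which are independent. This keeps the minimum
  in \<open>communication_height\<close> from ranging over an empty set.\<close>

lemma path_exists:
  assumes "A \<in> indep_sets L" "I \<in> indep_sets L"
  shows "\<exists>\<omega>. is_path L A \<omega> I"
proof -
  have "\<exists>\<omega>. is_path L A \<omega> (A - D)" if "finite D" for D
    using that
  proof induction
    case empty
    then show ?case using is_path_singleton[OF assms(1)] by auto
  next
    case (insert v D)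
    then obtain \<omega> where w: "is_path L A \<omega> (A - D)" by blast
    show ?case
    proof (cases "v \<in> A - D")
      case True
      have "is_path L A (\<omega> @ [A - D - {v}]) (A - D - {v})"
        using indep_sets_subset[OF assms(1), of "A - D - {v}"]
        by (intro is_path_snoc[OF w differ_in_one_vertex_remove[OF True]]) auto
      moreover have "A - insert v D = A - D - {v}"
        by auto
      ultimately show ?thesis
        by metis
    next
      case False
      then have "A - insert v D = A - D" by auto
      then show ?thesis using w by metis
    qed
  qed
  from this[OF indep_sets_finite[OF assms(1)]]
  have start: "\<exists>\<omega>. is_path L A \<omega> {}" by simp
  have "\<exists>\<omega>. is_path L A \<omega> D" if "finite D" "D \<subseteq> I" for D
    using that
  proof induction
    case (insert v D)
    then show ?case
      using is_path_snoc differ_in_one_vertex_insert[of v D]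
        indep_sets_subset[OF assms(2), of "insert v D"] by blast
  qed (use start in simp)
  then show ?thesis
    using indep_sets_finite[OF assms(2)] by blast
qed

text \<open>There may be infinitely many paths, but each maximum is the height of some independent
  set, so only finitely many values occur. Hence \<open>Min\<close> and \<open>Max\<close> have
  their usual meaning here.\<close>

lemma communication_height_le_iff:
  assumes "A \<in> indep_sets L" "I \<in> indep_sets L"
  shows "communication_height L A I \<le> h \<longleftrightarrow>
    (\<exists>\<omega>. is_path L A \<omega> I \<and> (\<forall>J\<in>set \<omega>. inefficiency L J \<le> h))"
proof -
  let ?H = "{Max (inefficiency L ` set \<omega>) | \<omega>. is_path L A \<omega> I}"
  have max_in: "Max (inefficiency L ` set \<omega>) \<in> inefficiency L ` set \<omega>" if "is_path L A \<omega> I" for \<omega>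
    using that by (intro Max_in) (auto simp: is_path_def)
  then have "?H \<subseteq> inefficiency L ` indep_sets L"
    unfolding is_path_def by blast
  then have fin: "finite ?H"
    using finite_indep_sets finite_subset by blast
  have "?H \<noteq> {}"
    using path_exists[OF assms] by auto
  from Min_le_iff[OF fin this, of h]
  have "communication_height L A I \<le> h \<longleftrightarrow>
      (\<exists>\<omega>. is_path L A \<omega> I \<and> Max (inefficiency L ` set \<omega>) \<le> h)"
    unfolding communication_height_def by blast
  also have "\<dots> \<longleftrightarrow> (\<exists>\<omega>. is_path L A \<omega> I \<and> (\<forall>J\<in>set \<omega>. inefficiency L J \<le> h))"
    by (intro ex_cong1 conj_cong refl, subst Max_le_iff) (auto simp: is_path_def)
  finally show ?thesis .
qed

section \<open>The well of the even ground state\<close>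

lemma even_well_iff:
  assumes "even L"
  shows "I \<in> even_well L \<longleftrightarrow>
    (\<exists>\<omega>. is_path L (even_sites L) \<omega> I \<and> (\<forall>J\<in>set \<omega>. inefficiency L J \<le> real L))"
proof -
  have "I \<in> indep_sets L" if "is_path L (even_sites L) \<omega> I" for \<omega>
    using that by (auto simp: is_path_def)
  then show ?thesis
    using communication_height_le_iff[OF even_sites_indep[OF assms]] unfolding even_well_def by blast
qed

lemma even_well_inefficiency:
  assumes "even L" "I \<in> even_well L"
  shows "inefficiency L I \<le> real L"
proof -
  obtain \<omega> where "is_path L (even_sites L) \<omega> I" "\<forall>J\<in>set \<omega>. inefficiency L J \<le> real L"
    using assms(2) unfolding even_well_iff[OF assms(1)] by blast
  then show ?thesis
    using last_in_set[of \<omega>] unfolding is_path_def by blast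
qed

text \<open>A path of height at most \<open>L\<close> can be prolonged by \<open>J\<close>. Read
  contrapositively, a single move leaves the well only by rising above height
  \<open>L\<close>.\<close>

lemma even_well_step:
  assumes "even L" "I \<in> even_well L" "differ_in_one_vertex I J" "J \<in> indep_sets L"
    "inefficiency L J \<le> real L"
  shows "J \<in> even_well L"
proof -
  obtain \<omega> where w: "is_path L (even_sites L) \<omega> I" "\<forall>J\<in>set \<omega>. inefficiency L J \<le> real L"
    using assms(2) unfolding even_well_iff[OF assms(1)] by blast
  have "\<forall>K\<in>set (\<omega> @ [J]). inefficiency L K \<le> real L"
    using w(2) assms(5) by simp
  with is_path_snoc[OF w(1) assms(3,4)] show ?thesis
    unfolding even_well_iff[OF assms(1)] by (intro exI[of _ "\<omega> @ [J]"] conjI)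
qed

lemma even_sites_in_even_well:
  assumes "even L"
  shows "even_sites L \<in> even_well L"
proof -
  have "real (2 * card (even_sites L)) = real (L * L)"
    using card_even_sites[OF assms] by simp
  then have "inefficiency L (even_sites L) = 0"
    by (simp add: inefficiency_def power2_eq_square)
  then have "\<forall>K\<in>set [even_sites L]. inefficiency L K \<le> real L"
    by simp
  with is_path_singleton[OF even_sites_indep[OF assms]] show ?thesis
    unfolding even_well_iff[OF assms] by (intro exI[of _ "[even_sites L]"] conjI)
qed

lemma cross_even_sites:
  assumes "L \<ge> 1"
  shows "cross L True (even_sites L)"
proof -
  have "full_row L True (even_sites L) 1" "full_column L True (even_sites L) 1"
    using assms by (auto simp: full_row_def full_column_def even_sites_def grid_def)
  then show ?thesis
    using assms unfolding cross_def by (meson atLeastAtMost_iff order_refl)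
qed

text \<open>A configuration of height exactly \<open>L\<close> need not contain a cross (remove a diagonal from a
  ground state), so the invariant allows one missing site.\<close>

lemma even_well_near_cross:
  assumes "I \<in> even_well L" "L \<ge> 4" "even L"
  obtains A w where "A \<in> indep_sets L" "cross L True A" "I \<subseteq> A" "A \<subseteq> insert w I"
proof -
  define near where "near I \<longleftrightarrow>
    (\<exists>A w. A \<in> indep_sets L \<and> cross L True A \<and> I \<subseteq> A \<and> A \<subseteq> insert w I)" for I
  \<comment> \<open>Of two neighbouring configurations of height at most \<open>L\<close>, the
    larger has height strictly below \<open>L\<close> and so contains a cross. It is the witness for
    \<open>near J\<close>: \<open>J\<close> itself after an insertion, \<open>I\<close> after a
    removal.\<close>
  have step: "near J"
    if near: "near I" and that: "differ_in_one_vertex I J" "I \<in> indep_sets L" "J \<in> indep_sets L"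
      "inefficiency L I \<le> real L" "inefficiency L J \<le> real L" for I J
  proof -
    obtain A w where A: "A \<in> indep_sets L" "cross L True A" "I \<subseteq> A" "A \<subseteq> insert w I"
      using near unfolding near_def by blast
    \<comment> \<open>All sites of \<open>K\<close> except possibly \<open>v\<close> lie in
      \<open>A\<close>, so an odd cross in \<open>K\<close> would clash with the even cross in
      \<open>A\<close>.\<close>
    have even_cross: "cross L True K"
      if K: "K \<in> indep_sets L" "inefficiency L K < real L" "K - {v} \<subseteq> I" for K v
    proof -
      have "real (L * L) < real (2 * card K + 2 * L)"
        using K(2) by (simp add: inefficiency_def power2_eq_square)
      then have "L * L < 2 * card K + 2 * L"
        by (simp only: of_nat_less_iff)
      then obtain p where p: "cross L p K"
        using cross_exists[OF K(1) assms(2,3)] by blast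
      have "\<not> cross L (\<not> True) K"
        using opposite_crosses[OF A(1) assms(2,3) A(2), of K v] K(3) A(3) by blast
      then show ?thesis
        using p by (cases p) auto
    qed
    show ?thesis
      using that(1)
    proof (cases rule: differ_in_one_vertex_cases)
      case (add v)
      then have "inefficiency L J < inefficiency L I"
        using indep_sets_finite[OF that(2)] by (simp add: inefficiency_def)
      then have "cross L True J"
        using add that by (intro even_cross[of J v]) auto
      then show ?thesis
        using that(3) unfolding near_def by blast
    next
      case (remove v)
      then have "card I = Suc (card J)"
        using card_Suc_Diff1[OF indep_sets_finite[OF that(2)] remove(1)] by simp
      then have "inefficiency L I < inefficiency L J"
        by (simp add: inefficiency_def)
      then have "cross L True I"
        using that by (intro even_cross[of I v]) auto
      then show ?thesis
        using that(2) remove unfolding near_def by blast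
    qed
  qed
  have "near (last \<omega>)"
    if "\<omega> \<noteq> []" "hd \<omega> = even_sites L" "set \<omega> \<subseteq> indep_sets L" "successively differ_in_one_vertex \<omega>"
      "\<forall>J\<in>set \<omega>. inefficiency L J \<le> real L" for \<omega>
    using that
  proof (induction \<omega> rule: rev_induct)
    case (snoc J \<omega>)
    show ?case
    proof (cases "\<omega> = []")
      case True
      then show ?thesis
        using snoc.prems even_sites_indep[OF assms(3)] cross_even_sites[of L] assms(2)
        unfolding near_def by auto
    next
      case False
      then have "near (last \<omega>)"
        using snoc by (intro snoc.IH) (auto simp: successively_append_iff)
      moreover have "last \<omega> \<in> set \<omega>" "differ_in_one_vertex (last \<omega>) J"
        using snoc.prems False by (auto simp: successively_append_iff)
      ultimately show ?thesis
        using snoc.prems step[of "last \<omega>" J] by auto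
    qed
  qed simp
  then have "near I"
    using assms(1) unfolding even_well_iff[OF assms(3)] is_path_def by blast
  then show ?thesis
    using that unfolding near_def by blast
qed

text \<open>Otherwise both \<open>I\<close> and its image would be one site away from an even cross.
  Reflecting the second cross back gives an odd cross that lies in \<open>I\<close> up to one site,
  against \<open>opposite_crosses\<close>.\<close>

lemma reflect_even_well:
  assumes "I \<in> even_well L" "L \<ge> 4" "even L"
  shows "reflect L ` I \<notin> even_well L"
proof
  assume refl: "reflect L ` I \<in> even_well L"
  obtain B w where B: "B \<in> indep_sets L" "cross L True B"
    "reflect L ` I \<subseteq> B" "B \<subseteq> insert w (reflect L ` I)"
    using even_well_near_cross[OF refl assms(2,3)] .
  obtain A w' where A: "A \<in> indep_sets L" "cross L True A" "I \<subseteq> A" "A \<subseteq> insert w' I"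
    using even_well_near_cross[OF assms] .
  have "I \<subseteq> grid L"
    using A by (auto simp: indep_sets_def)
  then have "reflect L ` B - {reflect L w} \<subseteq> I"
    using image_mono[OF B(4), of "reflect L"] reflect_image_reflect[of I L] by auto
  then show False
    using opposite_crosses[OF A(1) assms(2,3) A(2) cross_reflect[OF assms(3) B(2)]] A(3) by blast
qed

section \<open>Bottleneck bound for reversible jump processes\<close>

text \<open>Iterating subadditivity gives \<open>f t \<le> n * f (t / n)\<close>, which is
  \<open>t\<close> times the difference quotient at \<open>h = t / n\<close>; then \<open>n\<close>
  tends to infinity.\<close>

lemma subadditive_le_linear:
  fixes f :: "real \<Rightarrow> real"
  assumes sub: "\<And>s h. s > 0 \<Longrightarrow> h > 0 \<Longrightarrow> f (s + h) \<le> f s + f h"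
    and lim: "((\<lambda>h. f h / h) \<longlongrightarrow> c) (at_right 0)" and "t > 0"
  shows "f t \<le> t * c"
proof -
  \<comment> \<open>Multiples start at 1 because subadditivity is assumed at positive arguments
    only.\<close>
  have iter: "f (real (Suc n) * h) \<le> real (Suc n) * f h" if "h > 0" for n h
  proof (induction n)
    case (Suc n)
    have "f (real (Suc (Suc n)) * h) = f (real (Suc n) * h + h)"
      by (simp add: algebra_simps)
    also have "\<dots> \<le> f (real (Suc n) * h) + f h"
      using that by (intro sub) auto
    finally show ?case
      using Suc by (simp add: algebra_simps)
  qed simp
  have "filterlim (\<lambda>n. t / real (Suc n)) (at_right 0) sequentially"
    unfolding filterlim_at
    using \<open>t > 0\<close> LIMSEQ_Suc[OF lim_const_over_n[of t]] by simp
  from filterlim_compose[OF lim this]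
  have "(\<lambda>n. t * (f (t / real (Suc n)) / (t / real (Suc n)))) \<longlonglongrightarrow> t * c"
    by (rule tendsto_mult_left)
  moreover have "f t \<le> t * (f (t / real (Suc n)) / (t / real (Suc n)))" for n
    using iter[of "t / real (Suc n)" n] \<open>t > 0\<close> by (simp add: mult.commute)
  ultimately show ?thesis
    by (intro LIMSEQ_le_const) auto
qed

text \<open>With equal totals, the deficit of \<open>p\<close> on \<open>A\<close> equals its excess
  on the complement. Each is bounded by its part of the sum of absolute values, and the factor 1/2
  averages the two bounds.\<close>

lemma tv_norm_ge:
  assumes "A \<subseteq> S" "sum p S = sum r S" "finite S"
  shows "sum r A - sum p A \<le> tv_norm S p r"
proof -
  have "sum r A - sum p A \<le> (\<Sum>x\<in>A. \<bar>p x - r x\<bar>)"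
    unfolding sum_subtractf[symmetric] by (intro sum_mono) auto
  moreover have "sum r A - sum p A = sum p (S - A) - sum r (S - A)"
    using assms by (simp add: sum_diff)
  moreover have "sum p (S - A) - sum r (S - A) \<le> (\<Sum>x\<in>S - A. \<bar>p x - r x\<bar>)"
    unfolding sum_subtractf[symmetric] by (intro sum_mono) auto
  moreover have "(\<Sum>x\<in>S. \<bar>p x - r x\<bar>) = (\<Sum>x\<in>S - A. \<bar>p x - r x\<bar>) + (\<Sum>x\<in>A. \<bar>p x - r x\<bar>)"
    using assms by (simp add: sum.subset_diff)
  ultimately show ?thesis
    by (simp add: tv_norm_def)
qed

section \<open>Transition probabilities of a finite jump process\<close>

locale finite_jump_process =
  fixes S :: "'s set" and q :: "'s \<Rightarrow> 's \<Rightarrow> real"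
    and P :: "'s \<Rightarrow> 'w measure" and X :: "real \<Rightarrow> 'w \<Rightarrow> 's"
  assumes finite_states: "finite S" and jump: "markov_jump_process S q P X"
begin

definition trans_prob :: "real \<Rightarrow> 's \<Rightarrow> 's \<Rightarrow> real" where
  "trans_prob t x y = \<P>(\<omega> in P x. X t \<omega> = y)"

lemma trans_prob_nonneg: "trans_prob t x y \<ge> 0"
  by (simp add: trans_prob_def)

lemma
  assumes "x \<in> S"
  shows prob_space: "prob_space (P x)"
    and measurable: "t \<ge> 0 \<Longrightarrow> X t \<in> measurable (P x) (count_space S)"
    and initial: "AE \<omega> in P x. X 0 \<omega> = x"
    and rate: "y \<in> S \<Longrightarrow> x \<noteq> y \<Longrightarrow> ((\<lambda>h. trans_prob h x y / h) \<longlongrightarrow> q x y) (at_right 0)"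
  using jump assms unfolding markov_jump_process_def trans_prob_def by auto

lemma sets_state:
  assumes "x \<in> S" "t \<ge> 0" "y \<in> S"
  shows "{\<omega> \<in> space (P x). X t \<omega> = y} \<in> sets (P x)"
  using measurable_sets[OF measurable[OF assms(1,2)], of "{y}"] assms(3)
  by (simp add: vimage_def Int_def conj_commute)

text \<open>Partition by the state at time \<open>s\<close>. With a trivial event this gives total
  mass 1, with the state at a later time the Chapman-Kolmogorov equation.\<close>

lemma prob_split:
  assumes "x \<in> S" "s \<ge> 0" "{\<omega> \<in> space (P x). Q \<omega>} \<in> sets (P x)"
  shows "\<P>(\<omega> in P x. Q \<omega>) = (\<Sum>z\<in>S. \<P>(\<omega> in P x. X s \<omega> = z \<and> Q \<omega>))"
proof -
  interpret prob_space "P x" using prob_space[OF assms(1)] .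
  have eq: "{\<omega> \<in> space (P x). Q \<omega>} = (\<Union>z\<in>S. {\<omega> \<in> space (P x). X s \<omega> = z \<and> Q \<omega>})"
    using measurable_space[OF measurable[OF assms(1,2)]] by auto
  have "{\<omega> \<in> space (P x). X s \<omega> = z \<and> Q \<omega>} \<in> sets (P x)" if "z \<in> S" for z
  proof -
    have "{\<omega> \<in> space (P x). X s \<omega> = z \<and> Q \<omega>} =
        {\<omega> \<in> space (P x). X s \<omega> = z} \<inter> {\<omega> \<in> space (P x). Q \<omega>}"
      by auto
    then show ?thesis
      using sets_state[OF assms(1,2) that] assms(3) by auto
  qed
  then show ?thesis
    unfolding eq using finite_states
    by (intro finite_measure_finite_Union) (auto simp: disjoint_family_on_def)
qed

lemma sum_trans_prob:
  assumes "x \<in> S" "t \<ge> 0"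
  shows "(\<Sum>y\<in>S. trans_prob t x y) = 1"
proof -
  interpret prob_space "P x" using prob_space[OF assms(1)] .
  show ?thesis
    using prob_split[OF assms, of "\<lambda>_. True"] by (simp add: trans_prob_def prob_space)
qed

lemma chapman_kolmogorov:
  assumes "x \<in> S" "y \<in> S" "s \<ge> 0" "h \<ge> 0"
  shows "trans_prob (s + h) x y = (\<Sum>z\<in>S. trans_prob s x z * trans_prob h z y)"
proof -
  have "\<P>(\<omega> in P x. X s \<omega> = z \<and> X (s + h) \<omega> = y) = trans_prob s x z * trans_prob h z y"
    if "z \<in> S" for z
  proof -
    have "\<forall>x\<in>S. \<forall>T f s h y. finite T \<longrightarrow> T \<subseteq> {0..s} \<longrightarrow> s \<in> T \<longrightarrow> h \<ge> 0 \<longrightarrow> f ` T \<subseteq> S \<longrightarrow> y \<in> S \<longrightarrow>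
        \<P>(\<omega> in P x. (\<forall>r\<in>T. X r \<omega> = f r) \<and> X (s + h) \<omega> = y) =
        \<P>(\<omega> in P x. \<forall>r\<in>T. X r \<omega> = f r) * \<P>(\<omega> in P (f s). X h \<omega> = y)"
      using jump unfolding markov_jump_process_def by blast
    \<comment> \<open>A single observation time suffices: \<open>T = {s}\<close> with value
      \<open>z\<close>.\<close>
    from this[rule_format, of x "{s}" s h "\<lambda>_. z" y] show ?thesis
      using assms that by (simp add: trans_prob_def)
  qed
  then show ?thesis
    using prob_split[OF assms(1,3) sets_state[of x "s + h" y]] assms
    by (simp add: trans_prob_def)
qed

lemma trans_prob_0:
  assumes "x \<in> S" "y \<in> S" "x \<noteq> y"
  shows "trans_prob 0 x y = 0"
proof -
  interpret prob_space "P x" using prob_space[OF assms(1)] .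
  have "AE \<omega> in P x. X 0 \<omega> \<noteq> y"
    using initial[OF assms(1)] assms(3) by auto
  then show ?thesis
    using sets_state[OF assms(1) order_refl assms(2)]
    by (simp add: trans_prob_def prob_eq_0)
qed

text \<open>Transition probabilities out of \<open>x\<close> sum to 1, so the probability lost at
  \<open>x\<close> is a finite sum of off-diagonal terms whose rates are given. This is the diagonal
  of the generator.\<close>

lemma rate_diagonal:
  assumes "x \<in> S"
  shows "((\<lambda>h. (trans_prob h x x - 1) / h) \<longlongrightarrow> - (\<Sum>y\<in>S - {x}. q x y)) (at_right 0)"
proof -
  have "((\<lambda>h. - (\<Sum>y\<in>S - {x}. trans_prob h x y / h)) \<longlongrightarrow> - (\<Sum>y\<in>S - {x}. q x y)) (at_right 0)"
    using assms by (intro tendsto_minus tendsto_sum rate) auto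
  moreover have "(trans_prob h x x - 1) / h = - (\<Sum>y\<in>S - {x}. trans_prob h x y / h)"
    if "h > 0" for h
  proof -
    have "trans_prob h x x - 1 = - (\<Sum>y\<in>S - {x}. trans_prob h x y)"
      using sum_trans_prob[OF assms, of h] that finite_states assms
      by (simp add: sum.remove)
    then show ?thesis
      by (simp add: sum_divide_distrib)
  qed
  then have "\<forall>\<^sub>F h in at_right 0. - (\<Sum>y\<in>S - {x}. trans_prob h x y / h) = (trans_prob h x x - 1) / h"
    by (intro eventually_at_right_less[THEN eventually_mono]) simp
  ultimately show ?thesis
    by (rule Lim_transform_eventually)
qed

end

section \<open>Stationarity and the escape bound\<close>

locale reversible_jump_process = finite_jump_process +
  fixes \<pi> :: "'a \<Rightarrow> real"
  assumes pi_nonneg: "x \<in> S \<Longrightarrow> \<pi> x \<ge> 0"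
    and pi_sum: "(\<Sum>x\<in>S. \<pi> x) = 1"
    and detailed_balance: "x \<in> S \<Longrightarrow> y \<in> S \<Longrightarrow> x \<noteq> y \<Longrightarrow> \<pi> x * q x y = \<pi> y * q y x"
begin

text \<open>The summed absolute drift \<open>g\<close> is subadditive, because transition
  probabilities contract this norm, and detailed balance makes its derivative at 0 vanish. The
  linear bound then forces it to be 0, without solving the Kolmogorov equations.\<close>

lemma stationarity:
  assumes "t > 0" "y \<in> S"
  shows "(\<Sum>x\<in>S. \<pi> x * trans_prob t x y) = \<pi> y"
proof -
  define drift where "drift t y = (\<Sum>x\<in>S. \<pi> x * trans_prob t x y) - \<pi> y" for t y
  define g where "g t = (\<Sum>y\<in>S. \<bar>drift t y\<bar>)" for t
  \<comment> \<open>In matrix form, \<open>\<pi> P(s+h) - \<pi> = (\<pi> P(s) - \<pi>) P(h) + (\<pi>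
    P(h) - \<pi>)\<close>.\<close>
  have split: "drift (s + h) y = (\<Sum>z\<in>S. drift s z * trans_prob h z y) + drift h y"
    if "s > 0" "h > 0" "y \<in> S" for s h y
  proof -
    have "(\<Sum>x\<in>S. \<pi> x * trans_prob (s + h) x y) =
        (\<Sum>x\<in>S. \<Sum>z\<in>S. \<pi> x * trans_prob s x z * trans_prob h z y)"
      using that by (simp add: chapman_kolmogorov sum_distrib_left mult.assoc)
    also have "\<dots> = (\<Sum>z\<in>S. (\<Sum>x\<in>S. \<pi> x * trans_prob s x z) * trans_prob h z y)"
      by (subst sum.swap) (simp add: sum_distrib_right)
    finally show ?thesis
      by (simp add: drift_def left_diff_distrib sum_subtractf)
  qed
  have "g (s + h) \<le> g s + g h" if "s > 0" "h > 0" for s h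
  proof -
    have "g (s + h) \<le> (\<Sum>y\<in>S. (\<Sum>z\<in>S. \<bar>drift s z\<bar> * trans_prob h z y) + \<bar>drift h y\<bar>)"
      unfolding g_def
    proof (intro sum_mono)
      fix y assume "y \<in> S"
      have "\<bar>\<Sum>z\<in>S. drift s z * trans_prob h z y\<bar> \<le> (\<Sum>z\<in>S. \<bar>drift s z\<bar> * trans_prob h z y)"
        using sum_abs[of "\<lambda>z. drift s z * trans_prob h z y" S]
        by (simp add: abs_mult trans_prob_nonneg)
      then show "\<bar>drift (s + h) y\<bar> \<le> (\<Sum>z\<in>S. \<bar>drift s z\<bar> * trans_prob h z y) + \<bar>drift h y\<bar>"
        using split[OF that \<open>y \<in> S\<close>] by linarith
    qed
    also have "\<dots> = (\<Sum>z\<in>S. \<bar>drift s z\<bar> * (\<Sum>y\<in>S. trans_prob h z y)) + g h"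
      by (simp add: sum.distrib g_def sum_distrib_left) (rule sum.swap)
    also have "\<dots> = g s + g h"
      using that by (simp add: sum_trans_prob g_def)
    finally show ?thesis .
  qed
  moreover have "((\<lambda>h. g h / h) \<longlongrightarrow> 0) (at_right 0)"
  proof -
    have "((\<lambda>h. drift h y / h) \<longlongrightarrow> 0) (at_right 0)" if "y \<in> S" for y
    proof -
      have "((\<lambda>h. (\<Sum>x\<in>S - {y}. \<pi> x * (trans_prob h x y / h)) + \<pi> y * ((trans_prob h y y - 1) / h))
          \<longlongrightarrow> (\<Sum>x\<in>S - {y}. \<pi> x * q x y) + \<pi> y * - (\<Sum>x\<in>S - {y}. q y x)) (at_right 0)"
        using that by (intro tendsto_add tendsto_sum tendsto_mult_left rate rate_diagonal) auto
      \<comment> \<open>By detailed balance the flow into \<open>y\<close> equals the flow out of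
        it, so the limit of the drift quotient is 0.\<close>
      moreover have "(\<Sum>x\<in>S - {y}. \<pi> x * q x y) = \<pi> y * (\<Sum>x\<in>S - {y}. q y x)"
        unfolding sum_distrib_left using that detailed_balance[of _ y] by (intro sum.cong) auto
      moreover have "(\<Sum>x\<in>S - {y}. \<pi> x * (trans_prob h x y / h)) + \<pi> y * ((trans_prob h y y - 1) / h)
          = drift h y / h" for h
        using finite_states that
        by (simp add: drift_def sum.remove[of S y] sum_divide_distrib add_divide_distrib
            diff_divide_distrib right_diff_distrib)
      ultimately show ?thesis
        by simp
    qed
    then have "((\<lambda>h. \<Sum>y\<in>S. \<bar>drift h y / h\<bar>) \<longlongrightarrow> (\<Sum>y\<in>S. \<bar>0\<bar>)) (at_right 0)"
      by (intro tendsto_sum tendsto_rabs) auto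
    moreover have "\<forall>\<^sub>F h in at_right 0. (\<Sum>y\<in>S. \<bar>drift h y / h\<bar>) = g h / h"
      by (intro eventually_at_right_less[THEN eventually_mono])
        (simp add: g_def sum_divide_distrib abs_divide)
    ultimately show ?thesis
      by (auto intro: Lim_transform_eventually)
  qed
  ultimately have "g t \<le> t * 0"
    using \<open>t > 0\<close> by (rule subadditive_le_linear)
  moreover have "\<bar>drift t y\<bar> \<le> g t"
    unfolding g_def using finite_states assms by (intro member_le_sum) auto
  ultimately show ?thesis
    by (simp add: drift_def)
qed

text \<open>Condition on the state at the intermediate time \<open>s\<close>. If it is outside
  \<open>A\<close>, the contribution is at most \<open>F s\<close>; if it is inside, stationarity
  bounds the mass there by \<open>\<pi>\<close>, and the remaining escape contributes at most
  \<open>F h\<close>. So \<open>F\<close> is subadditive, with the stationary flow as its derivative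
  at 0.\<close>

lemma escape_prob_le:
  assumes "A \<subseteq> S" "t \<ge> 0"
  shows "(\<Sum>x\<in>A. \<Sum>y\<in>S - A. \<pi> x * trans_prob t x y) \<le> t * (\<Sum>x\<in>A. \<Sum>y\<in>S - A. \<pi> x * q x y)"
proof (cases "t = 0")
  case True
  have "trans_prob 0 x y = 0" if "x \<in> A" "y \<in> S - A" for x y
    using that assms by (intro trans_prob_0) auto
  then show ?thesis
    using True by simp
next
  case False
  define F where "F t = (\<Sum>x\<in>A. \<Sum>y\<in>S - A. \<pi> x * trans_prob t x y)" for t
  have "F (s + h) \<le> F s + F h" if "s > 0" "h > 0" for s h
  proof -
    \<comment> \<open>\<open>m\<close> is the mass carried from \<open>A\<close> to \<open>z\<close>
      by time \<open>s\<close>, and \<open>e\<close> below is the chance of being outside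
      \<open>A\<close> a time \<open>h\<close> later.\<close>
    define m where "m z = (\<Sum>x\<in>A. \<pi> x * trans_prob s x z)" for z
    define e where "e z = (\<Sum>y\<in>S - A. trans_prob h z y)" for z
    have m_nonneg: "m z \<ge> 0" for z
      unfolding m_def using assms
      by (intro sum_nonneg mult_nonneg_nonneg pi_nonneg trans_prob_nonneg) auto
    have m_le: "m z \<le> \<pi> z" if "z \<in> S" for z
    proof -
      have "m z \<le> (\<Sum>x\<in>S. \<pi> x * trans_prob s x z)"
        unfolding m_def using finite_states assms
        by (intro sum_mono2 mult_nonneg_nonneg pi_nonneg trans_prob_nonneg) auto
      then show ?thesis
        using stationarity[OF \<open>s > 0\<close> that] by simp
    qed
    have e_nonneg: "e z \<ge> 0" for z
      unfolding e_def by (intro sum_nonneg trans_prob_nonneg)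
    have e_le: "e z \<le> 1" if "z \<in> S" for z
    proof -
      have "e z \<le> (\<Sum>y\<in>S. trans_prob h z y)"
        unfolding e_def using finite_states by (intro sum_mono2 trans_prob_nonneg) auto
      then show ?thesis
        using sum_trans_prob[OF that, of h] \<open>h > 0\<close> by simp
    qed
    have "F (s + h) = (\<Sum>x\<in>A. \<Sum>y\<in>S - A. \<Sum>z\<in>S. \<pi> x * trans_prob s x z * trans_prob h z y)"
      unfolding F_def using that assms
      by (intro sum.cong) (auto simp: chapman_kolmogorov sum_distrib_left mult.assoc subset_iff)
    also have "\<dots> = (\<Sum>x\<in>A. \<Sum>z\<in>S. \<pi> x * trans_prob s x z * e z)"
      by (subst sum.swap[of _ S]) (simp add: e_def sum_distrib_left)
    also have "\<dots> = (\<Sum>z\<in>S. m z * e z)"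
      by (subst sum.swap) (simp add: m_def sum_distrib_right)
    also have "\<dots> = (\<Sum>z\<in>S - A. m z * e z) + (\<Sum>z\<in>A. m z * e z)"
      using finite_states assms by (simp add: sum.subset_diff)
    also have "\<dots> \<le> (\<Sum>z\<in>S - A. m z) + (\<Sum>z\<in>A. \<pi> z * e z)"
      using m_nonneg m_le e_nonneg e_le assms
      by (intro add_mono sum_mono mult_left_le mult_right_mono) auto
    also have "(\<Sum>z\<in>S - A. m z) = F s"
      unfolding F_def m_def by (rule sum.swap)
    also have "(\<Sum>z\<in>A. \<pi> z * e z) = F h"
      by (simp add: F_def e_def sum_distrib_left)
    finally show ?thesis .
  qed
  moreover have "((\<lambda>h. F h / h) \<longlongrightarrow> (\<Sum>x\<in>A. \<Sum>y\<in>S - A. \<pi> x * q x y)) (at_right 0)"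
  proof -
    have "((\<lambda>h. \<Sum>x\<in>A. \<Sum>y\<in>S - A. \<pi> x * (trans_prob h x y / h))
        \<longlongrightarrow> (\<Sum>x\<in>A. \<Sum>y\<in>S - A. \<pi> x * q x y)) (at_right 0)"
      using assms by (intro tendsto_sum tendsto_mult_left rate) auto
    then show ?thesis
      by (simp add: F_def sum_divide_distrib)
  qed
  ultimately show ?thesis
    using assms(2) False subadditive_le_linear[of F] unfolding F_def by auto
qed

text \<open>The complement of \<open>A\<close> has mass at least 1/2, so being within
  \<open>\<epsilon>\<close> of equilibrium forces every start in \<open>A\<close> to be outside with
  probability at least \<open>1/2 - \<epsilon>\<close>. Averaging over \<open>A\<close> gives a
  lower bound on the escape probability.\<close>

theorem bottleneck:
  assumes "A \<subseteq> S" "sum \<pi> A \<le> 1/2" "t \<ge> 0" "max_tv_distance S \<pi> P X t \<le> \<epsilon>"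
  shows "(1/2 - \<epsilon>) * sum \<pi> A \<le> t * (\<Sum>x\<in>A. \<Sum>y\<in>S - A. \<pi> x * q x y)"
proof -
  have compl: "sum \<pi> (S - A) \<ge> 1/2"
    using assms(1,2) finite_states pi_sum by (simp add: sum_diff)
  have "1/2 - \<epsilon> \<le> (\<Sum>y\<in>S - A. trans_prob t x y)" if "x \<in> A" for x
  proof -
    have "x \<in> S" using that assms(1) by auto
    have "sum \<pi> (S - A) - (\<Sum>y\<in>S - A. trans_prob t x y) \<le> tv_norm S (trans_prob t x) \<pi>"
      using finite_states sum_trans_prob[OF \<open>x \<in> S\<close> assms(3)] pi_sum
      by (intro tv_norm_ge) auto
    also have "tv_norm S (trans_prob t x) \<pi> \<le> max_tv_distance S \<pi> P X t"
      unfolding max_tv_distance_def trans_prob_def[abs_def]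
      using finite_states \<open>x \<in> S\<close> by (intro Max_ge) auto
    finally show ?thesis
      using compl assms(4) by linarith
  qed
  then have "(\<Sum>x\<in>A. \<pi> x * (1/2 - \<epsilon>)) \<le> (\<Sum>x\<in>A. \<pi> x * (\<Sum>y\<in>S - A. trans_prob t x y))"
    using assms(1) pi_nonneg by (intro sum_mono mult_left_mono) auto
  also have "\<dots> \<le> t * (\<Sum>x\<in>A. \<Sum>y\<in>S - A. \<pi> x * q x y)"
    using escape_prob_le[OF assms(1,3)] by (simp add: sum_distrib_left)
  finally show ?thesis
    by (simp add: sum_distrib_right mult.commute)
qed

end

section \<open>The bound for the activity process\<close>

lemma stationary_reflect: "I \<subseteq> grid L \<Longrightarrow> stationary L \<sigma> (reflect L ` I) = stationary L \<sigma> I"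
  by (simp add: stationary_def card_reflect)

lemma partition_function_pos: "\<sigma> > 0 \<Longrightarrow> (\<Sum>J\<in>indep_sets L. \<sigma> ^ card J :: real) > 0"
  by (rule sum_pos2[OF finite_indep_sets, of "{}"]) (auto simp: indep_sets_def)

lemma stationary_nonneg: "\<sigma> > 0 \<Longrightarrow> stationary L \<sigma> I \<ge> 0"
  using partition_function_pos[of \<sigma> L] by (simp add: stationary_def)

lemma sum_stationary: "\<sigma> > 0 \<Longrightarrow> (\<Sum>I\<in>indep_sets L. stationary L \<sigma> I) = 1"
  using partition_function_pos[of \<sigma> L] by (simp add: stationary_def sum_divide_distrib[symmetric])

lemma activity_rate_insert:
  "v \<notin> I \<Longrightarrow> insert v I \<in> indep_sets L \<Longrightarrow> activity_rate L \<sigma> I (insert v I) = \<sigma>"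
  unfolding activity_rate_def by (rule if_P) blast

lemma activity_rate_remove:
  assumes "v \<in> I"
  shows "activity_rate L \<sigma> I (I - {v}) = 1"
proof -
  have "\<nexists>w. w \<notin> I \<and> I - {v} = insert w I"
    using assms by auto
  then show ?thesis
    using assms by (auto simp: activity_rate_def)
qed

lemma activity_rate_nonzero: "activity_rate L \<sigma> I J \<noteq> 0 \<Longrightarrow> differ_in_one_vertex I J"
  using differ_in_one_vertex_insert differ_in_one_vertex_remove
  by (auto simp: activity_rate_def split: if_splits)

text \<open>Inserting a site multiplies the weight by \<open>\<sigma>\<close>, which is the ratio of
  the insertion rate \<open>\<sigma>\<close> to the removal rate 1.\<close>

lemma detailed_balance_insert:
  assumes "v \<notin> I" "insert v I \<in> indep_sets L"
  shows "stationary L \<sigma> I * activity_rate L \<sigma> I (insert v I) =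
    stationary L \<sigma> (insert v I) * activity_rate L \<sigma> (insert v I) I"
proof -
  have "finite I"
    using indep_sets_finite[OF assms(2)] by simp
  moreover have "activity_rate L \<sigma> (insert v I) I = 1"
    using activity_rate_remove[of v "insert v I" L \<sigma>] assms(1) by simp
  ultimately show ?thesis
    using assms by (simp add: activity_rate_insert stationary_def mult.commute)
qed

lemma activity_detailed_balance:
  assumes "I \<in> indep_sets L" "J \<in> indep_sets L"
  shows "stationary L \<sigma> I * activity_rate L \<sigma> I J = stationary L \<sigma> J * activity_rate L \<sigma> J I"
proof (cases "differ_in_one_vertex I J")
  case True
  then show ?thesis
  proof (cases rule: differ_in_one_vertex_cases)
    case (add v)
    then show ?thesis
      using detailed_balance_insert assms(2) by simp
  next
    case (remove v)
    then have "I = insert v J" "v \<notin> J"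
      by auto
    then show ?thesis
      using detailed_balance_insert[of v J L \<sigma>] assms(1) by simp
  qed
next
  case False
  then have "\<not> differ_in_one_vertex J I"
    by (simp add: differ_in_one_vertex_def Un_commute)
  then have "activity_rate L \<sigma> I J = 0" "activity_rate L \<sigma> J I = 0"
    using False activity_rate_nonzero by blast+
  then show ?thesis
    by simp
qed

section \<open>Mass of the well and flow out of it\<close>

lemma even_well_subset: "even_well L \<subseteq> indep_sets L"
  by (auto simp: even_well_def)

text \<open>The well and its reflection are disjoint and have equal mass, as reflection preserves
  cardinality.\<close>

lemma stationary_even_well_le_half:
  assumes "L \<ge> 4" "even L" "\<sigma> > 0"
  shows "sum (stationary L \<sigma>) (even_well L) \<le> 1/2"
proof -
  let ?R = "(`) (reflect L) ` even_well L"
  have grid: "I \<subseteq> grid L" if "I \<in> even_well L" for I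
    using that by (auto simp: even_well_def indep_sets_def)
  have fin: "finite (even_well L)"
    using finite_subset[OF even_well_subset finite_indep_sets] .
  have "inj_on ((`) (reflect L)) (even_well L)"
    using grid reflect_image_reflect by (metis inj_on_inverseI)
  then have "sum (stationary L \<sigma>) ?R = sum (stationary L \<sigma>) (even_well L)"
    by (simp add: sum.reindex stationary_reflect grid)
  moreover have "even_well L \<inter> ?R = {}"
    using reflect_even_well[OF _ assms(1,2)] by blast
  then have "sum (stationary L \<sigma>) (even_well L) + sum (stationary L \<sigma>) ?R =
      sum (stationary L \<sigma>) (even_well L \<union> ?R)"
    using fin by (simp add: sum.union_disjoint)
  moreover have "?R \<subseteq> indep_sets L"
    using reflect_indep_sets even_well_subset assms(1) by fastforce
  then have "sum (stationary L \<sigma>) (even_well L \<union> ?R) \<le> sum (stationary L \<sigma>) (indep_sets L)"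
    using even_well_subset finite_indep_sets stationary_nonneg[OF assms(3)] by (intro sum_mono2) auto
  ultimately show ?thesis
    using sum_stationary[OF assms(3), of L] by simp
qed

text \<open>An exit must raise the height from at most \<open>L\<close> to above \<open>L\<close>,
  so it removes a site. Heights are integers for even \<open>L\<close> and change by 1, which pins
  the height of \<open>I\<close> to exactly \<open>L\<close>; the last conclusion states this in
  naturals.\<close>

lemma even_well_exit:
  assumes "even L" "I \<in> even_well L" "J \<in> indep_sets L - even_well L" "differ_in_one_vertex I J"
  obtains v where "v \<in> I" "J = I - {v}" "2 * card I + 2 * L = L * L"
proof -
  have fin: "finite I"
    using assms(2) even_well_subset indep_sets_finite by blast
  have I: "inefficiency L I \<le> real L"
    using even_well_inefficiency assms(1,2) by blast
  have J: "inefficiency L J > real L"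
    using even_well_step[OF assms(1,2,4)] assms(3) by (meson DiffD1 DiffD2 not_le)
  show ?thesis
    using assms(4)
  proof (cases rule: differ_in_one_vertex_cases)
    case (add v)
    then show ?thesis
      using I J fin by (simp add: inefficiency_def)
  next
    case (remove v)
    then have "card I = Suc (card J)"
      using card_Suc_Diff1[OF fin remove(1)] by simp
    then have "real (L * L) \<le> real (2 * card I + 2 * L)" "real (2 * card I + 2 * L) < real (L * L + 2)"
      using I J by (simp_all add: inefficiency_def power2_eq_square)
    then have "L * L \<le> 2 * card I + 2 * L" "2 * card I + 2 * L < L * L + 2"
      by (simp_all only: of_nat_le_iff of_nat_less_iff)
    \<comment> \<open>Parity excludes \<open>L * L + 1\<close>, the other value between the two
      bounds.\<close>
    moreover have "even (L * L)"
      using assms(1) by simp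
    ultimately have "2 * card I + 2 * L = L * L"
      by presburger
    then show ?thesis
      using that remove by blast
  qed
qed

text \<open>Only boundary configurations contribute. Each has exactly \<open>m\<close> sites, so at
  most \<open>m\<close> removals of rate 1 lead out, and its weight times
  \<open>\<sigma> ^ L\<close> is that of the ground state, which has \<open>L\<close> more
  sites.\<close>

lemma even_well_flow_le:
  fixes \<sigma> :: real
  assumes "even L" "\<sigma> > 0"
  defines "m \<equiv> real (L\<^sup>2) / 2 - real L"
  shows "(\<Sum>I\<in>even_well L. \<Sum>J\<in>indep_sets L - even_well L. stationary L \<sigma> I * activity_rate L \<sigma> I J)
      * \<sigma> ^ L \<le> real (card (inner_boundary L (even_well L))) * m * stationary L \<sigma> (even_sites L)"
proof -
  let ?S = "even_well L" and ?B = "inner_boundary L (even_well L)" and ?\<pi> = "stationary L \<sigma>"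
  have fin: "finite ?S"
    using finite_subset[OF even_well_subset finite_indep_sets] .
  have zero: "(\<Sum>J\<in>indep_sets L - ?S. ?\<pi> I * activity_rate L \<sigma> I J) = 0" if "I \<in> ?S - ?B" for I
    using that activity_rate_nonzero by (intro sum.neutral) (force simp: inner_boundary_def)
  have bound: "(\<Sum>J\<in>indep_sets L - ?S. ?\<pi> I * activity_rate L \<sigma> I J) * \<sigma> ^ L \<le> m * ?\<pi> (even_sites L)"
    if I: "I \<in> ?B" for I
  proof -
    obtain J where J: "I \<in> ?S" "J \<in> indep_sets L - ?S" "differ_in_one_vertex I J"
      using I by (auto simp: inner_boundary_def)
    have card_I: "2 * card I + 2 * L = L * L"
      using even_well_exit[OF assms(1) J] by blast
    have fin_I: "finite I"
      using J(1) even_well_subset indep_sets_finite by blast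
    have "(\<Sum>J\<in>indep_sets L - ?S. activity_rate L \<sigma> I J) =
        (\<Sum>J\<in>(indep_sets L - ?S) \<inter> (\<lambda>v. I - {v}) ` I. activity_rate L \<sigma> I J)"
    proof (rule sum.mono_neutral_right)
      show "\<forall>J\<in>indep_sets L - ?S - (indep_sets L - ?S) \<inter> (\<lambda>v. I - {v}) ` I. activity_rate L \<sigma> I J = 0"
      proof (intro ballI, rule ccontr)
        fix K assume K: "K \<in> indep_sets L - ?S - (indep_sets L - ?S) \<inter> (\<lambda>v. I - {v}) ` I"
          and "activity_rate L \<sigma> I K \<noteq> 0"
        then obtain v where "v \<in> I" "K = I - {v}"
          using even_well_exit[OF assms(1) J(1), of K] activity_rate_nonzero[of L \<sigma> I K] by auto
        then show False
          using K by blast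
      qed
    qed (auto simp: finite_indep_sets)
    \<comment> \<open>Every exit is a removal of rate 1, so the total rate counts the exits, at most
      one for each site of \<open>I\<close>.\<close>
    also have "\<dots> = real (card ((indep_sets L - ?S) \<inter> (\<lambda>v. I - {v}) ` I))"
      using activity_rate_remove by (subst sum.cong[where h = "\<lambda>_. 1"]) auto
    also have "\<dots> \<le> real (card ((\<lambda>v. I - {v}) ` I))"
      using fin_I by (intro of_nat_mono card_mono) auto
    also have "\<dots> \<le> real (card I)"
      using fin_I by (simp add: card_image_le)
    also have "\<dots> = m"
      using arg_cong[OF card_I, of real] by (simp add: m_def power2_eq_square)
    finally have flow: "(\<Sum>J\<in>indep_sets L - ?S. activity_rate L \<sigma> I J) \<le> m" .
    have "card (even_sites L) = card I + L"
      using card_I card_even_sites[OF assms(1)] by simp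
    then have weight: "?\<pi> I * \<sigma> ^ L = ?\<pi> (even_sites L)"
      by (simp add: stationary_def power_add)
    have "(\<Sum>J\<in>indep_sets L - ?S. ?\<pi> I * activity_rate L \<sigma> I J) * \<sigma> ^ L =
        (\<Sum>J\<in>indep_sets L - ?S. activity_rate L \<sigma> I J) * (?\<pi> I * \<sigma> ^ L)"
      by (simp add: sum_distrib_left[symmetric])
    also have "\<dots> \<le> m * (?\<pi> I * \<sigma> ^ L)"
      unfolding weight using flow stationary_nonneg[OF assms(2)] by (intro mult_right_mono)
    finally show ?thesis
      by (simp add: weight)
  qed
  have "(\<Sum>I\<in>?S. \<Sum>J\<in>indep_sets L - ?S. ?\<pi> I * activity_rate L \<sigma> I J) =
      (\<Sum>I\<in>?B. \<Sum>J\<in>indep_sets L - ?S. ?\<pi> I * activity_rate L \<sigma> I J)"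
    using zero fin by (intro sum.mono_neutral_right) (auto simp: inner_boundary_def)
  then have "(\<Sum>I\<in>?S. \<Sum>J\<in>indep_sets L - ?S. ?\<pi> I * activity_rate L \<sigma> I J) * \<sigma> ^ L =
      (\<Sum>I\<in>?B. (\<Sum>J\<in>indep_sets L - ?S. ?\<pi> I * activity_rate L \<sigma> I J) * \<sigma> ^ L)"
    by (simp only: sum_distrib_right)
  also have "\<dots> \<le> (\<Sum>I\<in>?B. m * ?\<pi> (even_sites L))"
    by (intro sum_mono bound)
  finally show ?thesis
    by (simp add: mult.assoc)
qed

theorem theorem3p5:
  fixes L :: nat and \<sigma> \<epsilon> :: real
    and P :: "vertex set \<Rightarrow> 'w measure" and X :: "real \<Rightarrow> 'w \<Rightarrow> vertex set"
  assumes "L \<ge> 4" and "even L" and "\<sigma> > 1" and "\<epsilon> > 0"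
    and "activity_process L \<sigma> P X"
  shows "mixing_time (indep_sets L) (stationary L \<sigma>) P X \<epsilon> \<ge>
    ereal ((1/2 - 2 * \<epsilon>) *
      (\<sigma> ^ L / (real (card (inner_boundary L (even_well L))) * (real (L\<^sup>2) / 2 - real L))))"
proof -
  let ?S = "even_well L" and ?\<pi> = "stationary L \<sigma>"
  define K where "K = real (card (inner_boundary L ?S)) * (real (L\<^sup>2) / 2 - real L)"
  have pos: "\<sigma> > 0"
    using assms(3) by simp
  interpret reversible_jump_process "indep_sets L" "activity_rate L \<sigma>" P X ?\<pi>
    using finite_indep_sets assms(5) stationary_nonneg[OF pos] sum_stationary[OF pos]
      activity_detailed_balance
    by unfold_locales (auto simp: activity_process_def)
  have ge4: "real L \<ge> 4"
    using assms(1) by simp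
  then have "4 * real L \<le> real L * real L"
    by (intro mult_right_mono) auto
  then have K_nonneg: "K \<ge> 0"
    using ge4 by (simp add: K_def power2_eq_square)
  have "?\<pi> (even_sites L) > 0"
    using pos partition_function_pos[OF pos, of L] by (simp add: stationary_def)
  have "?\<pi> (even_sites L) \<le> sum ?\<pi> ?S"
    using even_sites_in_even_well[OF assms(2)] finite_subset[OF even_well_subset finite_indep_sets]
      stationary_nonneg[OF pos] by (intro member_le_sum) auto
  have "(1/2 - 2 * \<epsilon>) * (\<sigma> ^ L / K) \<le> t"
    if t: "t \<ge> 0" "max_tv_distance (indep_sets L) ?\<pi> P X t \<le> \<epsilon>" for t
  proof (cases "K = 0 \<or> 1/2 - 2 * \<epsilon> \<le> 0")
    case True
    \<comment> \<open>For \<open>K = 0\<close> the quotient is 0 by the convention on division;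
      otherwise the first factor is not positive.\<close>
    then have "(1/2 - 2 * \<epsilon>) * (\<sigma> ^ L / K) \<le> 0"
      using K_nonneg pos by (elim disjE) (auto intro!: mult_nonpos_nonneg divide_nonneg_nonneg simp del: times_divide_eq_right)
    then show ?thesis
      using t(1) by linarith
  next
    case False
    then have "K > 0" "1/2 - \<epsilon> \<ge> 0"
      using K_nonneg assms(4) by auto
    \<comment> \<open>The mass of the well is bounded below by the weight of the ground state alone,
      which also occurs in the flow bound and cancels.\<close>
    have "(1/2 - \<epsilon>) * ?\<pi> (even_sites L) * \<sigma> ^ L \<le> (1/2 - \<epsilon>) * sum ?\<pi> ?S * \<sigma> ^ L"
      using \<open>1/2 - \<epsilon> \<ge> 0\<close> pos \<open>?\<pi> (even_sites L) \<le> sum ?\<pi> ?S\<close>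
      by (intro mult_right_mono mult_left_mono) auto
    also have "\<dots> \<le> t * (\<Sum>I\<in>?S. \<Sum>J\<in>indep_sets L - ?S. ?\<pi> I * activity_rate L \<sigma> I J) * \<sigma> ^ L"
      using bottleneck[OF even_well_subset stationary_even_well_le_half[OF assms(1,2) pos] t] pos
      by (intro mult_right_mono) auto
    also have "\<dots> \<le> t * (K * ?\<pi> (even_sites L))"
      using even_well_flow_le[OF assms(2) pos] t(1)
      unfolding K_def mult.assoc[of t] by (intro mult_left_mono) auto
    finally have "(1/2 - \<epsilon>) * \<sigma> ^ L \<le> t * K"
      using \<open>?\<pi> (even_sites L) > 0\<close> by (simp add: mult.assoc[symmetric] mult.commute[of _ "\<sigma> ^ L"])
    \<comment> \<open>The argument yields the factor \<open>1/2 - \<epsilon>\<close>, which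
      dominates the claimed one.\<close>
    moreover have "(1/2 - 2 * \<epsilon>) * \<sigma> ^ L \<le> (1/2 - \<epsilon>) * \<sigma> ^ L"
      using assms(4) pos by (intro mult_right_mono) auto
    ultimately show ?thesis
      using \<open>K > 0\<close> by (simp add: field_simps)
  qed
  then show ?thesis
    unfolding mixing_time_def K_def[symmetric] by (intro Inf_greatest) auto
qed

end
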